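(* Let $G$ be a word hyperbolic group and let $H$ be an infinite quasi-convex subgroup of $G$. Then $H$ has finite index in its commensurator $Comm(H,G)$.
   Context: For a subgroup $H$ of a group $G$, the commensurator of $H$ in $G$ is $Comm(H,G)=\{g\in G : gHg^{-1}\cap H \text{ has finite index in both } H \text{ and } gHg^{-1}\}$; it is a subgroup of $G$ containing $H$. *)

theory Defs
  imports Complex_Main "HOL-Algebra.Algebra"
begin

definition finite_generating_set :: "('a, 'b) monoid_scheme \<Rightarrow> 'a set \<Rightarrow> bool" where
  "finite_generating_set G S \<longleftrightarrow> finite S \<and> S \<subseteq> carrier G \<and> generate G S = carrier G"

definition word_length :: "('a, 'b) monoid_scheme \<Rightarrow> 'a set \<Rightarrow> 'a \<Rightarrow> nat" where
  "word_length G S g =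
     (LEAST n. \<exists>ws. length ws = n \<and> set ws \<subseteq> S \<union> m_inv G ` S
                   \<and> foldr (\<otimes>\<^bsub>G\<^esub>) ws \<one>\<^bsub>G\<^esub> = g)"

text \<open>The left-invariant word metric, i.e. the path metric of the Cayley graph on its vertex set
  (edges join \<open>g\<close> to \<open>g \<otimes> s\<close> for \<open>s \<in> S\<close>).\<close>

definition word_dist :: "('a, 'b) monoid_scheme \<Rightarrow> 'a set \<Rightarrow> 'a \<Rightarrow> 'a \<Rightarrow> real" where
  "word_dist G S x y = real (word_length G S (inv\<^bsub>G\<^esub> x \<otimes>\<^bsub>G\<^esub> y))"

definition gromov_product :: "('a \<Rightarrow> 'a \<Rightarrow> real) \<Rightarrow> 'a \<Rightarrow> 'a \<Rightarrow> 'a \<Rightarrow> real" where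
  "gromov_product d w x y = (d w x + d w y - d x y) / 2"

text \<open>Gromov's definition of a hyperbolic metric space, which does not presuppose that the space is
  geodesic and hence applies directly to a group with a word metric.\<close>

definition gromov_hyperbolic :: "'a set \<Rightarrow> ('a \<Rightarrow> 'a \<Rightarrow> real) \<Rightarrow> bool" where
  "gromov_hyperbolic M d \<longleftrightarrow>
     (\<exists>\<delta>\<ge>0. \<forall>w\<in>M. \<forall>x\<in>M. \<forall>y\<in>M. \<forall>z\<in>M.
        gromov_product d w x z
          \<ge> min (gromov_product d w x y) (gromov_product d w y z) - \<delta>)"

definition word_hyperbolic_group :: "('a, 'b) monoid_scheme \<Rightarrow> bool" where
  "word_hyperbolic_group G \<longleftrightarrow>
     group G \<and> (\<exists>S. finite_generating_set G S \<and> gromov_hyperbolic (carrier G) (word_dist G S))"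

text \<open>The vertex sequence of a geodesic edge path of length \<open>n\<close> in the Cayley graph: consecutive
  vertices are at distance 1, hence adjacent. Values of \<open>p\<close> beyond \<open>n\<close> are irrelevant.\<close>

definition cayley_geodesic ::
    "('a, 'b) monoid_scheme \<Rightarrow> 'a set \<Rightarrow> nat \<Rightarrow> (nat \<Rightarrow> 'a) \<Rightarrow> bool" where
  "cayley_geodesic G S n p \<longleftrightarrow>
     p ` {..n} \<subseteq> carrier G \<and>
     (\<forall>i\<le>n. \<forall>j\<le>n. word_dist G S (p i) (p j) = \<bar>real i - real j\<bar>)"

definition quasiconvex_wrt :: "('a, 'b) monoid_scheme \<Rightarrow> 'a set \<Rightarrow> 'a set \<Rightarrow> bool" where
  "quasiconvex_wrt G S A \<longleftrightarrow>
     (\<exists>\<epsilon>\<ge>0. \<forall>n p. cayley_geodesic G S n p \<and> p 0 \<in> A \<and> p n \<in> A \<longrightarrow>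
        (\<forall>i\<le>n. \<exists>a\<in>A. word_dist G S (p i) a \<le> \<epsilon>))"

text \<open>In a word hyperbolic group quasi-convexity does not depend on the finite generating set; the
  set chosen here need not be the one witnessing hyperbolicity.\<close>

definition quasiconvex_subgroup :: "'a set \<Rightarrow> ('a, 'b) monoid_scheme \<Rightarrow> bool" where
  "quasiconvex_subgroup H G \<longleftrightarrow>
     subgroup H G \<and> (\<exists>S. finite_generating_set G S \<and> quasiconvex_wrt G S H)"

definition finite_index :: "('a, 'b) monoid_scheme \<Rightarrow> 'a set \<Rightarrow> 'a set \<Rightarrow> bool" where
  "finite_index G K H \<longleftrightarrow>
     subgroup K (G\<lparr>carrier := H\<rparr>) \<and> finite (rcosets\<^bsub>G\<lparr>carrier := H\<rparr>\<^esub> K)"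

definition conj_set :: "('a, 'b) monoid_scheme \<Rightarrow> 'a \<Rightarrow> 'a set \<Rightarrow> 'a set" where
  "conj_set G g H = (\<lambda>h. g \<otimes>\<^bsub>G\<^esub> h \<otimes>\<^bsub>G\<^esub> inv\<^bsub>G\<^esub> g) ` H"

definition commensurator :: "'a set \<Rightarrow> ('a, 'b) monoid_scheme \<Rightarrow> 'a set" where
  "commensurator H G =
     {g \<in> carrier G. finite_index G (conj_set G g H \<inter> H) H \<and>
                     finite_index G (conj_set G g H \<inter> H) (conj_set G g H)}"

end

theory Submission
  imports Defs "HOL-Real_Asymp.Real_Asymp"
begin

text \<open>If \<open>g\<close> commensurates \<open>H\<close>, then \<open>gH \<subseteq> HB\<close> for a finite set \<open>B\<close>, so \<open>gH\<close> lies in a bounded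
  neighbourhood of \<open>H\<close>. As both cosets are infinite and quasi-convex, two long quasi-geodesics with
  nearby endpoints show that some \<open>gh\<close> and some \<open>k \<in> H\<close> are at distance at most a constant \<open>R\<close> that is
  independent of \<open>g\<close>. Hence \<open>g \<in> HbH\<close> for one of the finitely many \<open>b = k\<inverse>gh\<close> in the ball of radius
  \<open>R\<close>, and \<open>bH \<subseteq> HB\<close> splits \<open>HbH\<close> into finitely many right cosets of \<open>H\<close>.

  The generating set \<open>T\<close> witnessing quasi-convexity may differ from the set \<open>S\<close> witnessing
  hyperbolicity. Geodesics for \<open>T\<close> are quasi-geodesics for \<open>S\<close>, and of the Morse lemma only the easy
  half is needed: geodesics stay close to quasi-geodesics with the same endpoints.\<close>

section \<open>Hyperbolic geometry\<close>

locale hyperbolic_premetric =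
  fixes M :: "'a set" and d :: "'a \<Rightarrow> 'a \<Rightarrow> real" and \<delta> :: real
  assumes refl: "x \<in> M \<Longrightarrow> d x x = 0"
    and commute: "\<lbrakk>x \<in> M; y \<in> M\<rbrakk> \<Longrightarrow> d x y = d y x"
    and triangle: "\<lbrakk>x \<in> M; y \<in> M; z \<in> M\<rbrakk> \<Longrightarrow> d x z \<le> d x y + d y z"
    and delta_nonneg: "0 \<le> \<delta>"
    and hyperbolic: "\<lbrakk>w \<in> M; x \<in> M; y \<in> M; z \<in> M\<rbrakk> \<Longrightarrow>
      min (gromov_product d w x y) (gromov_product d w y z) - \<delta> \<le> gromov_product d w x z"
begin

lemma nonneg: "\<lbrakk>x \<in> M; y \<in> M\<rbrakk> \<Longrightarrow> 0 \<le> d x y"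
  using triangle[of x y x] commute[of x y] refl[of x] by simp

lemma gromov_product_commute:
  "\<lbrakk>x \<in> M; y \<in> M\<rbrakk> \<Longrightarrow> gromov_product d w x y = gromov_product d w y x"
  by (simp add: gromov_product_def commute)

lemma hyperbolic_ge:
  assumes "w \<in> M" "x \<in> M" "y \<in> M" "z \<in> M"
    and "c \<le> gromov_product d w x y" "c \<le> gromov_product d w y z"
  shows "c - \<delta> \<le> gromov_product d w x z"
  using hyperbolic[OF assms(1-4)] assms(5,6) by linarith

text \<open>Bisecting the chain costs one \<open>\<delta>\<close> per halving, hence only logarithmically many.\<close>

lemma gromov_product_chain:
  assumes "w \<in> M" "\<And>i. i \<le> n \<Longrightarrow> f i \<in> M" "0 < n" "n \<le> 2 ^ k"
    and "\<And>i. i < n \<Longrightarrow> c \<le> gromov_product d w (f i) (f (Suc i))"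
  shows "c - real k * \<delta> \<le> gromov_product d w (f 0) (f n)"
  using assms(2-5)
proof (induction k arbitrary: n f)
  case 0
  then show ?case by (cases n) auto
next
  case (Suc k)
  show ?case
  proof (cases "n = 1")
    case True
    have "0 \<le> real (Suc k) * \<delta>" using delta_nonneg by simp
    then show ?thesis using Suc.prems(4)[of 0] True by simp
  next
    case False
    define m where "m = n div 2"
    have m: "0 < m" "m < n" "m \<le> 2 ^ k" "n - m \<le> 2 ^ k"
      using Suc.prems(2,3) False unfolding m_def by auto
    have 1: "c - real k * \<delta> \<le> gromov_product d w (f 0) (f m)"
      using Suc.prems m by (intro Suc.IH) auto
    have "c - real k * \<delta> \<le> gromov_product d w (f (0 + m)) (f (n - m + m))"
      using Suc.prems m by (intro Suc.IH[of "n - m" "\<lambda>i. f (i + m)"]) auto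
    then have 2: "c - real k * \<delta> \<le> gromov_product d w (f m) (f n)"
      using m by simp
    have "c - real k * \<delta> - \<delta> \<le> gromov_product d w (f 0) (f n)"
      using hyperbolic_ge[OF assms(1) _ _ _ 1 2] Suc.prems(1) m by simp
    then show ?thesis by (simp add: algebra_simps)
  qed
qed

text \<open>Neighbouring vertices at most \<mu> apart and at distance at least \<open>r\<close> from
  \<open>w\<close> have Gromov product at least \<open>r - \<mu> / 2\<close> at \<open>w\<close>.
  The chain estimate carries this bound from \<open>p i\<close> to \<open>p j\<close>, and symmetry
  removes the order of the indices.\<close>

lemma gromov_product_path:
  assumes "w \<in> M" "p ` {..n} \<subseteq> M" "i \<le> n" "j \<le> n" "\<bar>real i - real j\<bar> \<le> 2 ^ k" "0 \<le> \<mu>"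
    and step: "\<And>l. l < n \<Longrightarrow> d (p l) (p (Suc l)) \<le> \<mu>"
    and far: "\<And>l. l \<le> n \<Longrightarrow> r \<le> d w (p l)"
  shows "r - \<mu> / 2 - real k * \<delta> \<le> gromov_product d w (p i) (p j)"
proof -
  have mem: "p l \<in> M" if "l \<le> n" for l using assms(2) that by auto
  have k: "0 \<le> real k * \<delta>" using delta_nonneg by simp
  have main: "r - \<mu> / 2 - real k * \<delta> \<le> gromov_product d w (p i) (p j)"
    if ij: "i \<le> j" "j \<le> n" "real j - real i \<le> 2 ^ k" for i j
  proof (cases "i = j")
    case True
    then show ?thesis using far[of i] ij refl mem k assms(6) by (simp add: gromov_product_def)
  next
    case False
    have "real (j - i) \<le> real (2 ^ k)" using ij by simp
    then have le: "j - i \<le> 2 ^ k" by (simp only: of_nat_le_iff)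
    have "r - \<mu> / 2 - real k * \<delta> \<le> gromov_product d w (p (0 + i)) (p (j - i + i))"
    proof (rule gromov_product_chain[where f = "\<lambda>l. p (l + i)"])
      show "r - \<mu> / 2 \<le> gromov_product d w (p (l + i)) (p (Suc l + i))" if "l < j - i" for l
      proof -
        have "l + i < n" using that ij by linarith
        then show ?thesis
          using far[of "l + i"] far[of "Suc l + i"] step[of "l + i"]
          by (simp add: gromov_product_def)
      qed
    qed (use assms(1) mem ij False le in auto)
    then show ?thesis using ij by simp
  qed
  show ?thesis
  proof (cases "i \<le> j")
    case True
    then show ?thesis using main[of i j] assms by simp
  next
    case False
    then show ?thesis
      using main[of j i] assms gromov_product_commute[of "p i" "p j" w] mem by simp
  qed
qed

end

text \<open>The right-hand side is sublinear in \<open>r\<close>, so an estimate of \<open>r\<close>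
  in terms of its own logarithm becomes a bound by a constant depending only on \<delta> and
  \<Lambda>.\<close>

lemma log_growth_bound:
  fixes \<delta> \<Lambda> :: real
  assumes "0 \<le> \<delta>" "1 \<le> \<Lambda>"
  shows "\<exists>C. \<forall>r. r \<le> \<Lambda> / 2 + \<delta> * (3 + log 2 (\<Lambda> * (6 * r + 2))) \<longrightarrow> r \<le> C"
proof -
  have "((\<lambda>r. (\<Lambda> / 2 + \<delta> * (3 + log 2 (\<Lambda> * (6 * r + 2)))) / r) \<longlongrightarrow> 0) at_top"
    using assms by real_asymp
  then have "eventually (\<lambda>r. (\<Lambda> / 2 + \<delta> * (3 + log 2 (\<Lambda> * (6 * r + 2)))) / r < 1) at_top"
    by (rule order_tendstoD) simp
  then obtain C where C: "\<And>r. C \<le> r \<Longrightarrow> (\<Lambda> / 2 + \<delta> * (3 + log 2 (\<Lambda> * (6 * r + 2)))) / r < 1"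
    by (auto simp: eventually_at_top_linorder)
  show ?thesis
  \<comment> \<open>The maximum with 1 makes every larger \<open>r\<close> positive, so that the
    quotient bound can be multiplied out.\<close>
  proof (intro exI[of _ "max C 1"] allI impI)
    fix r assume "r \<le> \<Lambda> / 2 + \<delta> * (3 + log 2 (\<Lambda> * (6 * r + 2)))"
    then show "r \<le> max C 1"
      using C[of r] by (cases "max C 1 < r") (auto simp: divide_less_eq)
  qed
qed

section \<open>Quasi-geodesics and the geodesics between their endpoints\<close>

definition geodesic_seq :: "('a \<Rightarrow> 'a \<Rightarrow> real) \<Rightarrow> nat \<Rightarrow> (nat \<Rightarrow> 'a) \<Rightarrow> bool" where
  "geodesic_seq d n p \<longleftrightarrow> (\<forall>i\<le>n. \<forall>j\<le>n. d (p i) (p j) = \<bar>real i - real j\<bar>)"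

text \<open>Bounding single steps suffices: in a premetric the triangle inequality extends the bound
  to \<open>d (p i) (p j) \<le> \<Lambda> * \<bar>real i - real j\<bar>\<close>. On integer
  parameters no additive constant is included.\<close>

definition quasigeodesic_seq :: "real \<Rightarrow> ('a \<Rightarrow> 'a \<Rightarrow> real) \<Rightarrow> nat \<Rightarrow> (nat \<Rightarrow> 'a) \<Rightarrow> bool" where
  "quasigeodesic_seq \<Lambda> d n p \<longleftrightarrow>
     (\<forall>i\<le>n. \<forall>j\<le>n. \<bar>real i - real j\<bar> \<le> \<Lambda> * d (p i) (p j)) \<and>
     (\<forall>i<n. d (p i) (p (Suc i)) \<le> \<Lambda>)"

context hyperbolic_premetric
begin

text \<open>The easy half of the Morse lemma. At a point \<open>q i\<close> of the geodesic that is as far as possible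
  from \<open>p\<close>, at distance \<open>r\<close> say, the geodesic is bypassed by a piece of \<open>p\<close> with \<open>O(r)\<close> vertices, so
  that \<open>r\<close> is at most logarithmic in \<open>r\<close>.\<close>

lemma geodesic_near_quasigeodesic:
  assumes "1 \<le> \<Lambda>"
  obtains C where "\<And>n p m q i. \<lbrakk>p ` {..n} \<subseteq> M; q ` {..m} \<subseteq> M; quasigeodesic_seq \<Lambda> d n p;
    geodesic_seq d m q; q 0 = p 0; q m = p n; i \<le> m\<rbrakk> \<Longrightarrow> \<exists>j\<le>n. d (q i) (p j) \<le> C"
proof -
  obtain C where C: "\<And>r. r \<le> \<Lambda> / 2 + \<delta> * (3 + log 2 (\<Lambda> * (6 * r + 2))) \<Longrightarrow> r \<le> C"
    using log_growth_bound[OF delta_nonneg assms] by blast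
  have "\<exists>j\<le>n. d (q i') (p j) \<le> C"
    if pM: "p ` {..n} \<subseteq> M" and qM: "q ` {..m} \<subseteq> M" and quasi: "quasigeodesic_seq \<Lambda> d n p"
      and geo: "geodesic_seq d m q" and start: "q 0 = p 0" and stop: "q m = p n" and i': "i' \<le> m"
    for n p m q i'
  proof -
    have pm: "p j \<in> M" if "j \<le> n" for j using pM that by auto
    have qm: "q j \<in> M" if "j \<le> m" for j using qM that by auto
    have qd: "d (q a) (q b) = \<bar>real a - real b\<bar>" if "a \<le> m" "b \<le> m" for a b
      using geo that by (simp add: geodesic_seq_def)
    define h where "h a = Min ((\<lambda>j. d (q a) (p j)) ` {..n})" for a
    have h_le: "h a \<le> d (q a) (p j)" if "j \<le> n" for a j
      unfolding h_def using that by (intro Min_le) auto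
    have h_ex: "\<exists>j\<le>n. d (q a) (p j) = h a" for a
    proof -
      have "h a \<in> (\<lambda>j. d (q a) (p j)) ` {..n}"
        unfolding h_def by (intro Min_in) auto
      then show ?thesis by auto
    qed
    define r where "r = Max (h ` {..m})"
    have r_ge: "h a \<le> r" if "a \<le> m" for a
      unfolding r_def using that by (intro Max_ge) auto
    have "r \<in> h ` {..m}" unfolding r_def by (intro Max_in) auto
    then obtain i where i: "i \<le> m" "h i = r" by auto
    have far: "r \<le> d (q i) (p j)" if "j \<le> n" for j using h_le[OF that, of i] i by simp
    have r0: "0 \<le> r" using h_ex[of i] i nonneg qm pm by metis
    \<comment> \<open>A point \<open>q a\<close> at distance \<open>e \<ge> 2 * r\<close> from
      \<open>q i\<close> has a vertex of \<open>p\<close> within \<open>r\<close>, while that vertex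
      is at least \<open>r\<close> away from \<open>q i\<close>. Hence their Gromov product at
      \<open>q i\<close> is at least \<open>(2 * r + r - r) / 2 = r\<close>.\<close>
    define e where "e = nat \<lceil>2 * r\<rceil>"
    have e: "2 * r \<le> real e" "real e \<le> 2 * r + 1" unfolding e_def using r0 by linarith+
    have near: "\<exists>j\<le>n. r \<le> gromov_product d (q i) (q a) (p j) \<and> d (q a) (p j) \<le> r"
      if "a \<le> m" "d (q i) (q a) = e" for a
    proof -
      obtain j where "j \<le> n" "d (q a) (p j) = h a" using h_ex by blast
      then show ?thesis
        using far[of j] r_ge[OF that(1)] that(2) e(1)
        by (intro exI[of _ j]) (simp add: gromov_product_def)
    qed
    \<comment> \<open>Walk back \<open>e\<close> steps along \<open>q\<close>. If \<open>q\<close>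
      starts earlier, its first point is \<open>p 0\<close> itself, and the Gromov product is then
      just \<open>d (q i) (p 0) \<ge> r\<close>. The point \<open>q b\<close> on the other side is
      found in the same way.\<close>
    have "\<exists>a j. a \<le> i \<and> j \<le> n \<and> real i - real a \<le> 2 * r + 1 \<and>
            r \<le> gromov_product d (q i) (q a) (p j) \<and> d (q a) (p j) \<le> r"
    proof (cases "e \<le> i")
      case True
      then have "real i - real (i - e) \<le> 2 * r + 1" "d (q i) (q (i - e)) = e"
        using qd[of i "i - e"] i e(2) by auto
      then show ?thesis using near[of "i - e"] i
        by (meson diff_le_self order.trans)
    next
      case False
      then show ?thesis using far[of 0] start pm[of 0] refl[of "p 0"] e(2) r0
        by (intro exI[of _ "0::nat"]) (auto simp: gromov_product_def)
    qed
    then obtain a j where a: "a \<le> i" "j \<le> n" "real i - real a \<le> 2 * r + 1"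
        "r \<le> gromov_product d (q i) (q a) (p j)" "d (q a) (p j) \<le> r" by blast
    have "\<exists>b k. i \<le> b \<and> b \<le> m \<and> k \<le> n \<and> real b - real i \<le> 2 * r + 1 \<and>
            r \<le> gromov_product d (q i) (q b) (p k) \<and> d (q b) (p k) \<le> r"
    proof (cases "i + e \<le> m")
      case True
      then have "real (i + e) - real i \<le> 2 * r + 1" "d (q i) (q (i + e)) = e"
        using qd[of i "i + e"] i e(2) by auto
      then show ?thesis using near[of "i + e"] True
        by (meson le_add1)
    next
      case False
      then show ?thesis using far[of n] stop pm[of n] refl[of "p n"] e(2) r0 i
        by (intro exI[of _ m] exI[of _ n]) (auto simp: gromov_product_def)
    qed
    then obtain b k where b: "i \<le> b" "b \<le> m" "k \<le> n" "real b - real i \<le> 2 * r + 1"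
        "r \<le> gromov_product d (q i) (q b) (p k)" "d (q b) (p k) \<le> r" by blast
    have am: "a \<le> m" using a i by simp
    \<comment> \<open>The detour through \<open>q a\<close> and \<open>q b\<close> has length at
      most \<open>r + 2 * (2 * r + 1) + r\<close>.\<close>
    have "d (p j) (p k) \<le> d (p j) (q a) + (d (q a) (q b) + d (q b) (p k))"
      using triangle[of "p j" "q a" "p k"] triangle[of "q a" "q b" "p k"] am a b pm qm by simp
    also have "\<dots> \<le> 6 * r + 2"
      using commute[of "p j" "q a"] qd[OF am b(2)] am a b pm qm by simp
    finally have pjk: "d (p j) (p k) \<le> 6 * r + 2" .
    have "\<bar>real j - real k\<bar> \<le> \<Lambda> * d (p j) (p k)"
      using quasi a b by (simp add: quasigeodesic_seq_def)
    also have "\<dots> \<le> \<Lambda> * (6 * r + 2)" using pjk assms by (intro mult_left_mono) auto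
    finally have jk: "\<bar>real j - real k\<bar> \<le> \<Lambda> * (6 * r + 2)" .
    have arg: "1 \<le> \<Lambda> * (6 * r + 2)"
      using mult_mono[of 1 \<Lambda> 1 "6 * r + 2"] assms r0 by simp
    \<comment> \<open>\<open>2 ^ l\<close> bounds the index gap between \<open>p j\<close> and
      \<open>p k\<close>. Rounding the logarithm up costs one more \<delta> in the final
      bound.\<close>
    define l where "l = nat \<lceil>log 2 (\<Lambda> * (6 * r + 2))\<rceil>"
    have log0: "0 \<le> log 2 (\<Lambda> * (6 * r + 2))" using arg by simp
    have l: "log 2 (\<Lambda> * (6 * r + 2)) \<le> l" "l \<le> log 2 (\<Lambda> * (6 * r + 2)) + 1"
      unfolding l_def using log0 by linarith+
    have "\<Lambda> * (6 * r + 2) \<le> 2 powr l" using l(1) arg by (simp add: log_le_iff)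
    then have "\<bar>real j - real k\<bar> \<le> 2 ^ l" using jk by (simp add: powr_realpow)
    then have "r - \<Lambda> / 2 - real l * \<delta> \<le> gromov_product d (q i) (p j) (p k)"
      using gromov_product_path[where w = "q i" and \<mu> = \<Lambda>, OF _ pM a(2) b(3)] far quasi assms qm i
      by (simp add: quasigeodesic_seq_def)
    moreover have "r - \<Lambda> / 2 - real l * \<delta> \<le> r"
      using assms mult_nonneg_nonneg[of "real l" \<delta>] delta_nonneg by linarith
    ultimately have "r - \<Lambda> / 2 - real l * \<delta> - \<delta> \<le> gromov_product d (q i) (q a) (p k)"
      using hyperbolic_ge[of "q i" "q a" "p j" "p k"] a b qm pm i am by simp
    moreover have "r - \<Lambda> / 2 - real l * \<delta> - \<delta> \<le> gromov_product d (q i) (p k) (q b)"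
      using \<open>r - \<Lambda> / 2 - real l * \<delta> \<le> r\<close> b gromov_product_commute[of "p k" "q b"] delta_nonneg pm qm
      by simp
    ultimately have "r - \<Lambda> / 2 - real l * \<delta> - \<delta> - \<delta> \<le> gromov_product d (q i) (q a) (q b)"
      using hyperbolic_ge[OF qm qm pm qm] b i am by blast
    \<comment> \<open>\<open>q i\<close> lies between \<open>q a\<close> and \<open>q b\<close> on a
      geodesic, so their Gromov product at \<open>q i\<close> vanishes, although the chain
      \<open>q a\<close>, \<open>p j\<close>, \<open>p k\<close>, \<open>q b\<close> bounds it from
      below by roughly \<open>r\<close>.\<close>
    also have "\<dots> = 0" using qd i am b(1,2) a(1) by (simp add: gromov_product_def)
    finally have "r \<le> \<Lambda> / 2 + \<delta> * (2 + real l)" by (simp add: algebra_simps)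
    also have "\<dots> \<le> \<Lambda> / 2 + \<delta> * (3 + log 2 (\<Lambda> * (6 * r + 2)))"
      using l(2) delta_nonneg by (intro add_left_mono mult_left_mono) auto
    finally have "r \<le> C" by (rule C)
    then show ?thesis using h_ex[of i'] r_ge[OF i'] by fastforce
  qed
  then show ?thesis by (rule that)
qed

text \<open>The position \<open>s\<close> is the foot of \<open>z\<close> in the comparison tripod,
  and \<open>q i\<close> is \<open>s\<close> rounded down, which costs the 1. As \<open>q i\<close>
  lies on the geodesic, the product of the ends at \<open>q i\<close> is 0, so hyperbolicity makes
  the product of \<open>z\<close> with one of the ends at most \<delta>. Either case bounds
  \<open>d z (q i)\<close>.\<close>

lemma geodesic_near_point:
  assumes z: "z \<in> M" and qM: "q ` {..m} \<subseteq> M" and geo: "geodesic_seq d m q"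
  shows "\<exists>i\<le>m. d z (q i) \<le> gromov_product d z (q 0) (q m) + 2 * \<delta> + 1"
proof -
  have qm: "q j \<in> M" if "j \<le> m" for j using qM that by auto
  define s where "s = (d z (q 0) - d z (q m) + real m) / 2"
  have len: "d (q 0) (q m) = m" using geo by (simp add: geodesic_seq_def)
  have s: "0 \<le> s" "s \<le> m"
    using triangle[of z "q 0" "q m"] triangle[of "q 0" z "q m"] triangle[of z "q m" "q 0"]
      commute[of "q 0" "q m"] commute[of "q 0" z] len z qm unfolding s_def by auto
  define i where "i = nat \<lfloor>s\<rfloor>"
  have i: "real i \<le> s" "s \<le> real i + 1" unfolding i_def using s by linarith+
  have im: "i \<le> m" using i s by linarith
  have "d (q 0) (q i) = i" "d (q i) (q m) = real m - i" using geo im by (auto simp: geodesic_seq_def)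
  moreover have "d (q i) (q 0) = d (q 0) (q i)" "d (q i) z = d z (q i)" "d (q m) z = d z (q m)"
    using commute qm im z by auto
  moreover have "gromov_product d (q i) (q 0) z - \<delta> \<le> gromov_product d (q i) (q 0) (q m) \<or>
      gromov_product d (q i) z (q m) - \<delta> \<le> gromov_product d (q i) (q 0) (q m)"
    using hyperbolic[OF qm[OF im] qm[OF le0] z qm[OF order_refl]] by (auto simp: min_def split: if_splits)
  ultimately have "d z (q i) \<le> gromov_product d z (q 0) (q m) + 2 * \<delta> + 1"
    using i len commute[OF z qm[OF le0]]
    unfolding s_def gromov_product_def add_divide_distrib diff_divide_distrib
    by (elim disjE) linarith+
  then show ?thesis using im by blast
qed

text \<open>Seen from the midpoint \<open>z\<close> of a geodesic joining the ends of
  \<open>p\<close>, nearby endpoints are almost the same direction, so a geodesic joining the ends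
  of \<open>p'\<close> also passes near \<open>z\<close>. Both geodesics are close to their
  quasi-geodesics. \<open>D\<close> enters only through the required length, hence not into
  \<open>R\<close>.\<close>

lemma quasigeodesics_meet:
  assumes "1 \<le> \<Lambda>"
    and geodesic: "\<And>x y. x \<in> M \<Longrightarrow> y \<in> M \<Longrightarrow>
      \<exists>m q. q ` {..m} \<subseteq> M \<and> geodesic_seq d m q \<and> q 0 = x \<and> q m = y"
  obtains R where "\<And>D n p n' p'. \<lbrakk>p ` {..n} \<subseteq> M; p' ` {..n'} \<subseteq> M;
      quasigeodesic_seq \<Lambda> d n p; quasigeodesic_seq \<Lambda> d n' p';
      d (p 0) (p' 0) \<le> D; d (p n) (p' n') \<le> D; 2 * D + 4 * \<delta> + 2 \<le> d (p 0) (p n)\<rbrakk> \<Longrightarrow>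
    \<exists>i\<le>n. \<exists>j\<le>n'. d (p i) (p' j) \<le> R"
proof (rule geodesic_near_quasigeodesic[OF assms(1)])
  fix C assume C: "\<And>n p m q i. \<lbrakk>p ` {..n} \<subseteq> M; q ` {..m} \<subseteq> M; quasigeodesic_seq \<Lambda> d n p;
      geodesic_seq d m q; q 0 = p 0; q m = p n; i \<le> m\<rbrakk> \<Longrightarrow> \<exists>j\<le>n. d (q i) (p j) \<le> C"
  have "\<exists>i\<le>n. \<exists>j\<le>n'. d (p i) (p' j) \<le> 2 * C + 4 * \<delta> + 1"
    if pM: "p ` {..n} \<subseteq> M" and pM': "p' ` {..n'} \<subseteq> M"
      and quasi: "quasigeodesic_seq \<Lambda> d n p" and quasi': "quasigeodesic_seq \<Lambda> d n' p'"
      and D: "d (p 0) (p' 0) \<le> D" "d (p n) (p' n') \<le> D" and long: "2 * D + 4 * \<delta> + 2 \<le> d (p 0) (p n)"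
    for D n p n' p'
  proof -
    have pm: "p j \<in> M" if "j \<le> n" for j using pM that by auto
    have pm': "p' j \<in> M" if "j \<le> n'" for j using pM' that by auto
    obtain m q where q: "q ` {..m} \<subseteq> M" "geodesic_seq d m q" "q 0 = p 0" "q m = p n"
      using geodesic[OF pm[OF le0] pm[OF order_refl]] by blast
    obtain m' q' where q': "q' ` {..m'} \<subseteq> M" "geodesic_seq d m' q'" "q' 0 = p' 0" "q' m' = p' n'"
      using geodesic[OF pm'[OF le0] pm'[OF order_refl]] by blast
    \<comment> \<open>For odd \<open>m\<close> the midpoint is off by one half. The summand 2 in the
      length hypothesis absorbs this and keeps the next inequalities strict.\<close>
    define c where "c = m div 2"
    define z where "z = q c"
    have cm: "c \<le> m" unfolding c_def by simp
    have zM: "z \<in> M" unfolding z_def using q(1) cm by auto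
    have len: "d (p 0) (p n) = m"
      unfolding q(3,4)[symmetric] using q(2) by (simp add: geodesic_seq_def)
    have dz: "d z (p 0) = c" "d z (p n) = real m - c"
      unfolding z_def q(3,4)[symmetric] using q(2) cm by (simp_all add: geodesic_seq_def)
    have "real m \<le> 2 * c + 1" "2 * c \<le> m" unfolding c_def by linarith+
    then have mid: "D + 2 * \<delta> < d z (p 0)" "D + 2 * \<delta> < d z (p n)"
      using long dz len by linarith+
    have 1: "2 * \<delta> < gromov_product d z (p 0) (p' 0)"
      using mid(1) D(1) triangle[of z "p' 0" "p 0"] commute[of "p' 0" "p 0"] zM pm pm'
      by (simp add: gromov_product_def)
    have 2: "2 * \<delta> < gromov_product d z (p' n') (p n)"
      using mid(2) D(2) triangle[of z "p' n'" "p n"] commute[of "p' n'" "p n"] zM pm pm'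
      by (simp add: gromov_product_def)
    have 3: "gromov_product d z (p 0) (p n) = 0"
      using dz len by (simp add: gromov_product_def)
    \<comment> \<open>Otherwise hyperbolicity along \<open>p 0\<close>, \<open>p' 0\<close>,
      \<open>p' n'\<close>, \<open>p n\<close>, at the cost of two \<delta>, would make the product
      of \<open>p 0\<close> and \<open>p n\<close> at \<open>z\<close> positive, against fact
      3.\<close>
    have "gromov_product d z (p' 0) (p' n') \<le> 2 * \<delta>"
      using hyperbolic[OF zM pm[of 0] pm'[of 0] pm[of n]]
        hyperbolic[OF zM pm'[of 0] pm'[of n'] pm[of n]] 1 2 3
        delta_nonneg by (auto simp: min_def split: if_splits)
    then obtain i where i: "i \<le> m'" "d z (q' i) \<le> 4 * \<delta> + 1"
      using geodesic_near_point[OF zM q'(1,2)] q'(3,4) by force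
    obtain j where j: "j \<le> n" "d z (p j) \<le> C"
      using C[OF pM q(1) quasi q(2-4) cm] unfolding z_def by blast
    obtain k where k: "k \<le> n'" "d (q' i) (p' k) \<le> C"
      using C[OF pM' q'(1) quasi' q'(2-4) i(1)] by blast
    have "q' i \<in> M" using q'(1) i(1) by auto
    then have "d (p j) (p' k) \<le> d z (p j) + (d z (q' i) + d (q' i) (p' k))"
      using triangle[of "p j" z "p' k"] triangle[of z "q' i" "p' k"] commute[of z "p j"] zM pm pm' j k
      by simp
    also have "\<dots> \<le> 2 * C + 4 * \<delta> + 1" using i j k by simp
    finally show ?thesis using j k by blast
  qed
  then show ?thesis by (rule that)
qed

end

section \<open>Word metrics\<close>

context group
begin

lemma foldr_mult_closed: "set ws \<subseteq> carrier G \<Longrightarrow> foldr (\<otimes>) ws \<one> \<in> carrier G"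
  by (induction ws) auto

lemma foldr_mult_append:
  "\<lbrakk>set us \<subseteq> carrier G; set ws \<subseteq> carrier G\<rbrakk> \<Longrightarrow>
    foldr (\<otimes>) (us @ ws) \<one> = foldr (\<otimes>) us \<one> \<otimes> foldr (\<otimes>) ws \<one>"
  by (induction us) (auto simp: foldr_mult_closed m_assoc simp del: foldr_append)

lemma foldr_mult_rev_inv:
  "set ws \<subseteq> carrier G \<Longrightarrow> foldr (\<otimes>) (map (m_inv G) (rev ws)) \<one> = inv (foldr (\<otimes>) ws \<one>)"
proof (induction ws)
  case (Cons a ws)
  then have "set (map (m_inv G) (rev ws)) \<subseteq> carrier G" by auto
  then show ?case
    using Cons foldr_mult_append[of "map (m_inv G) (rev ws)" "[inv a]"]
    by (simp add: foldr_mult_closed inv_mult_group del: foldr_append)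
qed simp

lemma generate_word:
  assumes "S \<subseteq> carrier G" "g \<in> generate G S"
  shows "\<exists>ws. set ws \<subseteq> S \<union> m_inv G ` S \<and> foldr (\<otimes>) ws \<one> = g"
  using assms(2)
proof induction
  case one
  show ?case by (intro exI[of _ "[]"]) simp
next
  case (incl h)
  then show ?case using assms(1) by (intro exI[of _ "[h]"]) auto
next
  case (inv h)
  then show ?case using assms(1) by (intro exI[of _ "[inv h]"]) auto
next
  case (eng h1 h2)
  then obtain us ws where "set us \<subseteq> S \<union> m_inv G ` S" "foldr (\<otimes>) us \<one> = h1"
    "set ws \<subseteq> S \<union> m_inv G ` S" "foldr (\<otimes>) ws \<one> = h2" by blast
  moreover have "S \<union> m_inv G ` S \<subseteq> carrier G" using assms(1) by auto
  ultimately show ?case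
    using foldr_mult_append[of us ws] by (intro exI[of _ "us @ ws"]) auto
qed

end

text \<open>The generating set is a parameter, so that the same group can be interpreted with
  \<open>S\<close> and with \<open>T\<close> side by side.\<close>

locale finitely_generated_group = group G for G (structure) +
  fixes S
  assumes generating: "finite_generating_set G S"
begin

definition letters where "letters = S \<union> m_inv G ` S"

lemma letters_closed: "letters \<subseteq> carrier G"
  using generating by (auto simp: letters_def finite_generating_set_def)

lemma finite_letters: "finite letters"
  using generating by (simp add: letters_def finite_generating_set_def)

lemma inv_letters: "x \<in> letters \<Longrightarrow> inv x \<in> letters"
  using generating by (auto simp: letters_def finite_generating_set_def)

lemma word_length_le:
  "\<lbrakk>set ws \<subseteq> letters; foldr (\<otimes>) ws \<one> = g\<rbrakk> \<Longrightarrow> word_length G S g \<le> length ws"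
  unfolding word_length_def letters_def by (rule Least_le) blast

text \<open>The \<open>LEAST\<close> in \<open>word_length\<close> is attained because
  \<open>S\<close> generates the group.\<close>

lemma word_length_word:
  assumes "g \<in> carrier G"
  obtains ws where "length ws = word_length G S g" "set ws \<subseteq> letters" "foldr (\<otimes>) ws \<one> = g"
proof -
  have "\<exists>n ws. length ws = n \<and> set ws \<subseteq> letters \<and> foldr (\<otimes>) ws \<one> = g"
    using generate_word[of S g] generating assms
    by (auto simp: letters_def finite_generating_set_def)
  then have "\<exists>ws. length ws = word_length G S g \<and> set ws \<subseteq> letters \<and> foldr (\<otimes>) ws \<one> = g"
    unfolding word_length_def letters_def[symmetric] by (rule LeastI_ex)
  then show thesis using that by blast
qed

lemma word_length_one: "word_length G S \<one> = 0"
  using word_length_le[of "[]" \<one>] by simp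

lemma word_length_mult:
  assumes "x \<in> carrier G" "y \<in> carrier G"
  shows "word_length G S (x \<otimes> y) \<le> word_length G S x + word_length G S y"
proof -
  obtain us where us: "length us = word_length G S x" "set us \<subseteq> letters" "foldr (\<otimes>) us \<one> = x"
    using word_length_word[OF assms(1)] .
  obtain ws where ws: "length ws = word_length G S y" "set ws \<subseteq> letters" "foldr (\<otimes>) ws \<one> = y"
    using word_length_word[OF assms(2)] .
  have "foldr (\<otimes>) (us @ ws) \<one> = x \<otimes> y"
    using foldr_mult_append[of us ws] us ws letters_closed by auto
  then show ?thesis using word_length_le[of "us @ ws" "x \<otimes> y"] us ws by auto
qed

lemma word_length_inv_le:
  assumes "x \<in> carrier G"
  shows "word_length G S (inv x) \<le> word_length G S x"
proof -
  obtain ws where ws: "length ws = word_length G S x" "set ws \<subseteq> letters" "foldr (\<otimes>) ws \<one> = x"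
    using word_length_word[OF assms] .
  have "foldr (\<otimes>) (map (m_inv G) (rev ws)) \<one> = inv x"
    using foldr_mult_rev_inv[of ws] ws letters_closed by auto
  then show ?thesis
    using word_length_le[of "map (m_inv G) (rev ws)" "inv x"] ws inv_letters by auto
qed

lemma word_length_inv:
  "x \<in> carrier G \<Longrightarrow> word_length G S (inv x) = word_length G S x"
  using word_length_inv_le[of x] word_length_inv_le[of "inv x"] by simp

lemma word_dist_refl: "x \<in> carrier G \<Longrightarrow> word_dist G S x x = 0"
  by (simp add: word_dist_def word_length_one)

lemma word_dist_commute:
  "\<lbrakk>x \<in> carrier G; y \<in> carrier G\<rbrakk> \<Longrightarrow> word_dist G S x y = word_dist G S y x"
  using word_length_inv[of "inv x \<otimes> y"] by (simp add: word_dist_def inv_mult_group)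

lemma word_dist_triangle:
  assumes "x \<in> carrier G" "y \<in> carrier G" "z \<in> carrier G"
  shows "word_dist G S x z \<le> word_dist G S x y + word_dist G S y z"
proof -
  have "(inv x \<otimes> y) \<otimes> (inv y \<otimes> z) = inv x \<otimes> (y \<otimes> inv y) \<otimes> z"
    using assms by (simp only: m_assoc inv_closed m_closed)
  then have "(inv x \<otimes> y) \<otimes> (inv y \<otimes> z) = inv x \<otimes> z" using assms by simp
  then show ?thesis
    using word_length_mult[of "inv x \<otimes> y" "inv y \<otimes> z"] assms by (simp add: word_dist_def)
qed

text \<open>There are only finitely many words of bounded length. This forces an infinite
  \<open>H\<close> out of every ball, and it limits the double coset representatives to a finite
  set.\<close>

lemma finite_word_ball: "finite {g \<in> carrier G. word_length G S g \<le> n}"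
proof (rule finite_subset)
  show "{g \<in> carrier G. word_length G S g \<le> n} \<subseteq>
      (\<lambda>ws. foldr (\<otimes>) ws \<one>) ` {ws. set ws \<subseteq> letters \<and> length ws \<le> n}"
  proof
    fix g assume g: "g \<in> {g \<in> carrier G. word_length G S g \<le> n}"
    then obtain ws where "length ws = word_length G S g" "set ws \<subseteq> letters" "foldr (\<otimes>) ws \<one> = g"
      using word_length_word by blast
    then show "g \<in> (\<lambda>ws. foldr (\<otimes>) ws \<one>) ` {ws. set ws \<subseteq> letters \<and> length ws \<le> n}"
      using g by force
  qed
qed (simp add: finite_lists_length_le finite_letters)

text \<open>The prefixes of a shortest word for \<open>inv x \<otimes> y\<close> trace the
  geodesic.\<close>

lemma cayley_geodesic_exists:
  assumes "x \<in> carrier G" "y \<in> carrier G"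
  shows "\<exists>n p. cayley_geodesic G S n p \<and> p 0 = x \<and> p n = y"
proof -
  define g where "g = inv x \<otimes> y"
  have g: "g \<in> carrier G" using assms by (simp add: g_def)
  obtain ws where ws: "length ws = word_length G S g" "set ws \<subseteq> letters" "foldr (\<otimes>) ws \<one> = g"
    using word_length_word[OF g] .
  define n where "n = length ws"
  define p where "p i = x \<otimes> foldr (\<otimes>) (take i ws) \<one>" for i
  have wsc: "set ws \<subseteq> carrier G" using ws letters_closed by blast
  have sub: "set (take j (drop i ws)) \<subseteq> letters" for i j
    using ws(2) set_take_subset[of j "drop i ws"] set_drop_subset[of i ws] by blast
  have takec: "foldr (\<otimes>) (take i ws) \<one> \<in> carrier G" for i
    using set_take_subset[of i ws] wsc by (intro foldr_mult_closed) blast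
  have pc: "p i \<in> carrier G" for i using assms takec by (simp add: p_def)
  have p0: "p 0 = x" using assms by (simp add: p_def)
  have "x \<otimes> (inv x \<otimes> y) = y" using assms by (simp add: m_assoc[symmetric])
  then have pn: "p n = y" using ws(3) by (simp add: p_def n_def g_def)
  have step: "word_dist G S (p i) (p j) \<le> real j - real i" if "i \<le> j" "j \<le> n" for i j
  proof -
    let ?v = "take (j - i) (drop i ws)"
    have v: "foldr (\<otimes>) ?v \<one> \<in> carrier G" using sub letters_closed by (intro foldr_mult_closed) blast
    have "take j ws = take i ws @ ?v" using that by (metis le_add_diff_inverse take_add)
    then have "foldr (\<otimes>) (take j ws) \<one> = foldr (\<otimes>) (take i ws) \<one> \<otimes> foldr (\<otimes>) ?v \<one>"
      using foldr_mult_append[of "take i ws" ?v] sub letters_closed set_take_subset[of i ws] wsc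
      by (metis order.trans)
    then have "p j = p i \<otimes> foldr (\<otimes>) ?v \<one>"
      using assms takec v by (simp add: p_def m_assoc)
    then have "inv (p i) \<otimes> p j = foldr (\<otimes>) ?v \<one>"
      using pc v by (simp add: m_assoc[symmetric])
    then have "word_length G S (inv (p i) \<otimes> p j) \<le> length ?v"
      using word_length_le[OF sub] by simp
    also have "\<dots> \<le> j - i" by simp
    finally show ?thesis using that by (simp add: word_dist_def)
  qed
  have whole: "word_dist G S (p 0) (p n) = n"
    using p0 pn ws(1) by (simp add: word_dist_def g_def n_def)
  \<comment> \<open>The upper bounds for the stretches from 0 to \<open>i\<close>, \<open>i\<close>
    to \<open>j\<close> and \<open>j\<close> to \<open>n\<close> add up to the full distance
    \<open>n\<close>, so none of them can be strict.\<close>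
  have eq: "word_dist G S (p i) (p j) = real j - real i" if "i \<le> j" "j \<le> n" for i j
    using step[of 0 i] step[of j n] step[of i j] that whole
      word_dist_triangle[OF pc[of 0] pc[of i] pc[of n]] word_dist_triangle[OF pc[of i] pc[of j] pc[of n]]
    by simp
  have "word_dist G S (p i) (p j) = \<bar>real i - real j\<bar>" if "i \<le> n" "j \<le> n" for i j
    using eq[of i j] eq[of j i] word_dist_commute[OF pc pc, of i j] that by (cases "i \<le> j") auto
  then have "cayley_geodesic G S n p" using pc by (auto simp: cayley_geodesic_def)
  then show ?thesis using p0 pn by blast
qed

lemma word_dist_left_mult:
  assumes "g \<in> carrier G" "x \<in> carrier G" "y \<in> carrier G"
  shows "word_dist G S (g \<otimes> x) (g \<otimes> y) = word_dist G S x y"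
proof -
  have "inv (g \<otimes> x) \<otimes> (g \<otimes> y) = inv x \<otimes> (inv g \<otimes> g) \<otimes> y"
    using assms by (simp only: inv_mult_group m_assoc inv_closed m_closed)
  then show ?thesis using assms by (simp add: word_dist_def)
qed

lemma cayley_geodesic_left_mult:
  assumes "g \<in> carrier G" "cayley_geodesic G S n p"
  shows "cayley_geodesic G S n (\<lambda>i. g \<otimes> p i)"
proof -
  have "p i \<in> carrier G" if "i \<le> n" for i
    using assms(2) that by (auto simp: cayley_geodesic_def)
  then show ?thesis using assms by (auto simp: cayley_geodesic_def word_dist_left_mult)
qed

text \<open>Spell each letter of a shortest \<open>T\<close>-word as an \<open>S\<close>-word;
  \<open>K\<close> is the largest \<open>S\<close>-length of a \<open>T\<close>-letter, or 1.
  Exchanging \<open>S\<close> and \<open>T\<close> makes the two metrics bi-Lipschitz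
  equivalent.\<close>

lemma word_length_lipschitz:
  assumes "finitely_generated_group G T"
  shows "\<exists>K\<ge>1. \<forall>g\<in>carrier G. real (word_length G S g) \<le> K * real (word_length G T g)"
proof -
  interpret T: finitely_generated_group G T by fact
  define K where "K = Max (insert 1 (word_length G S ` T.letters))"
  have fin: "finite (insert 1 (word_length G S ` T.letters))" using T.finite_letters by simp
  have K1: "1 \<le> K" unfolding K_def using fin by (intro Max_ge) auto
  have K: "word_length G S s \<le> K" if "s \<in> T.letters" for s
    unfolding K_def using fin that by (intro Max_ge) auto
  have words: "word_length G S (foldr (\<otimes>) ws \<one>) \<le> K * length ws" if "set ws \<subseteq> T.letters" for ws
    using that
  proof (induction ws)
    case (Cons s ws)
    then have "s \<in> carrier G" "foldr (\<otimes>) ws \<one> \<in> carrier G"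
      using T.letters_closed by (auto intro!: foldr_mult_closed)
    then show ?case using word_length_mult[of s "foldr (\<otimes>) ws \<one>"] K[of s] Cons by force
  qed (simp add: word_length_one)
  have "word_length G S g \<le> K * word_length G T g" if g: "g \<in> carrier G" for g
  proof -
    obtain ws where "length ws = word_length G T g" "set ws \<subseteq> T.letters" "foldr (\<otimes>) ws \<one> = g"
      using T.word_length_word[OF g] .
    then show ?thesis using words[of ws] by simp
  qed
  then have "\<forall>g\<in>carrier G. real (word_length G S g) \<le> real K * real (word_length G T g)"
    by (metis of_nat_le_iff of_nat_mult)
  then show ?thesis using K1 by (intro exI[of _ "real K"]) auto
qed

end

section \<open>Commensurating cosets\<close>

text \<open>Since \<open>gH\<close> is infinite, it contains geodesics that are long compared with \<open>D\<close>; their middle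
  parts are close to \<open>H\<close> independently of \<open>D\<close>.\<close>

lemma close_cosets_uniformly_close:
  fixes G (structure)
  assumes S: "finitely_generated_group G S" and hyp: "gromov_hyperbolic (carrier G) (word_dist G S)"
    and T: "finitely_generated_group G T" and qc: "quasiconvex_wrt G T H"
    and H: "subgroup H G" "infinite H"
  obtains R where "\<And>g D. \<lbrakk>g \<in> carrier G; \<And>h. h \<in> H \<Longrightarrow> \<exists>k\<in>H. word_dist G S (g \<otimes> h) k \<le> D\<rbrakk> \<Longrightarrow>
    \<exists>h\<in>H. \<exists>k\<in>H. word_dist G S (g \<otimes> h) k \<le> R"
proof -
  interpret S: finitely_generated_group G S by fact
  interpret T: finitely_generated_group G T by fact
  interpret H: subgroup H G by fact
  obtain K1 where K1: "1 \<le> K1"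
    "\<And>g. g \<in> carrier G \<Longrightarrow> real (word_length G S g) \<le> K1 * real (word_length G T g)"
    using S.word_length_lipschitz[OF T] by blast
  obtain K2 where K2: "1 \<le> K2"
    "\<And>g. g \<in> carrier G \<Longrightarrow> real (word_length G T g) \<le> K2 * real (word_length G S g)"
    using T.word_length_lipschitz[OF S] by blast
  define \<Lambda> where "\<Lambda> = max K1 K2"
  have \<Lambda>: "1 \<le> \<Lambda>" using K1 by (simp add: \<Lambda>_def)
  have ST: "word_dist G S x y \<le> \<Lambda> * word_dist G T x y" if "x \<in> carrier G" "y \<in> carrier G" for x y
  proof -
    have "word_dist G S x y \<le> K1 * word_dist G T x y"
      unfolding word_dist_def using that by (intro K1) simp
    also have "\<dots> \<le> \<Lambda> * word_dist G T x y"
      unfolding \<Lambda>_def by (intro mult_right_mono) (auto simp: word_dist_def)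
    finally show ?thesis .
  qed
  have TS: "word_dist G T x y \<le> \<Lambda> * word_dist G S x y" if "x \<in> carrier G" "y \<in> carrier G" for x y
  proof -
    have "word_dist G T x y \<le> K2 * word_dist G S x y"
      unfolding word_dist_def using that by (intro K2) simp
    also have "\<dots> \<le> \<Lambda> * word_dist G S x y"
      unfolding \<Lambda>_def by (intro mult_right_mono) (auto simp: word_dist_def)
    finally show ?thesis .
  qed
  \<comment> \<open>A step of a \<open>T\<close>-geodesic has \<open>T\<close>-length 1, so
    comparing the metrics in both directions gives both conditions with the same \<Lambda>.\<close>
  have quasi: "quasigeodesic_seq \<Lambda> (word_dist G S) n p" if "cayley_geodesic G T n p" for n p
    unfolding quasigeodesic_seq_def
  proof (intro conjI allI impI)
    have pc: "p i \<in> carrier G" if "i \<le> n" for i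
      using \<open>cayley_geodesic G T n p\<close> that by (auto simp: cayley_geodesic_def)
    have pd: "word_dist G T (p i) (p j) = \<bar>real i - real j\<bar>" if "i \<le> n" "j \<le> n" for i j
      using \<open>cayley_geodesic G T n p\<close> that by (auto simp: cayley_geodesic_def)
    show "\<bar>real i - real j\<bar> \<le> \<Lambda> * word_dist G S (p i) (p j)" if "i \<le> n" "j \<le> n" for i j
      using TS[OF pc pc, of i j] pd[of i j] that by simp
    show "word_dist G S (p i) (p (Suc i)) \<le> \<Lambda>" if "i < n" for i
      using ST[OF pc pc, of i "Suc i"] pd[of i "Suc i"] that by simp
  qed
  obtain \<delta> where \<delta>: "0 \<le> \<delta>" "\<forall>w\<in>carrier G. \<forall>x\<in>carrier G. \<forall>y\<in>carrier G. \<forall>z\<in>carrier G.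
      min (gromov_product (word_dist G S) w x y) (gromov_product (word_dist G S) w y z) - \<delta>
        \<le> gromov_product (word_dist G S) w x z"
    using hyp unfolding gromov_hyperbolic_def by blast
  interpret hyperbolic_premetric "carrier G" "word_dist G S" \<delta>
    using \<delta> S.word_dist_refl S.word_dist_commute S.word_dist_triangle by unfold_locales auto
  have geod: "\<exists>m q. q ` {..m} \<subseteq> carrier G \<and> geodesic_seq (word_dist G S) m q \<and> q 0 = x \<and> q m = y"
    if "x \<in> carrier G" "y \<in> carrier G" for x y
    using S.cayley_geodesic_exists[OF that] unfolding cayley_geodesic_def geodesic_seq_def by blast
  obtain \<epsilon> where "\<forall>n p. cayley_geodesic G T n p \<and> p 0 \<in> H \<and> p n \<in> H \<longrightarrow>
      (\<forall>i\<le>n. \<exists>a\<in>H. word_dist G T (p i) a \<le> \<epsilon>)"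
    using qc unfolding quasiconvex_wrt_def by (elim exE conjE)
  then have \<epsilon>: "\<exists>a\<in>H. word_dist G T (p i) a \<le> \<epsilon>"
    if "cayley_geodesic G T n p" "p 0 \<in> H" "p n \<in> H" "i \<le> n" for n p i
    using that by simp
  have \<epsilon>': "word_dist G S x y \<le> \<Lambda> * \<epsilon>"
    if "word_dist G T x y \<le> \<epsilon>" "x \<in> carrier G" "y \<in> carrier G" for x y
    using ST[OF that(2,3)] mult_left_mono[OF that(1), of \<Lambda>] \<Lambda> by linarith
  show thesis
  proof (rule quasigeodesics_meet[OF \<Lambda> geod])
    fix R assume R: "\<And>D n p n' p'. \<lbrakk>p ` {..n} \<subseteq> carrier G; p' ` {..n'} \<subseteq> carrier G;
      quasigeodesic_seq \<Lambda> (word_dist G S) n p; quasigeodesic_seq \<Lambda> (word_dist G S) n' p';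
      word_dist G S (p 0) (p' 0) \<le> D; word_dist G S (p n) (p' n') \<le> D;
      2 * D + 4 * \<delta> + 2 \<le> word_dist G S (p 0) (p n)\<rbrakk> \<Longrightarrow>
      \<exists>i\<le>n. \<exists>j\<le>n'. word_dist G S (p i) (p' j) \<le> R"
    \<comment> \<open>The path from \<open>gH\<close> to \<open>H\<close> goes from a coset point to
      \<open>p i\<close>, across to \<open>p' j\<close>, and on to a point of \<open>H\<close>;
      quasi-convexity pays for both ends.\<close>
    have "\<exists>h\<in>H. \<exists>k\<in>H. word_dist G S (g \<otimes> h) k \<le> \<Lambda> * \<epsilon> + R + \<Lambda> * \<epsilon>"
      if g: "g \<in> carrier G" and D: "\<And>h. h \<in> H \<Longrightarrow> \<exists>k\<in>H. word_dist G S (g \<otimes> h) k \<le> D" for g D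
    proof -
      \<comment> \<open>An element of \<open>H\<close> outside the ball of radius \<open>N\<close>
        makes \<open>p\<close> long enough for the two quasi-geodesics to meet.\<close>
      define N where "N = nat \<lceil>2 * D + 4 * \<delta> + 2\<rceil>"
      have "\<not> H \<subseteq> {g \<in> carrier G. word_length G S g \<le> N}"
        using H(2) S.finite_word_ball finite_subset by blast
      then obtain h where h: "h \<in> H" "h \<notin> {g \<in> carrier G. word_length G S g \<le> N}" by blast
      have hc: "h \<in> carrier G" using h by simp
      have far: "N < word_length G S h" using h(2) hc by simp
      obtain k0 k1 where k: "k0 \<in> H" "word_dist G S (g \<otimes> \<one>) k0 \<le> D"
          "k1 \<in> H" "word_dist G S (g \<otimes> h) k1 \<le> D"
        using D[OF H.one_closed] D[OF h(1)] by blast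
      obtain n p where p: "cayley_geodesic G T n p" "p 0 = g \<otimes> \<one>" "p n = g \<otimes> h"
        using T.cayley_geodesic_exists[of "g \<otimes> \<one>" "g \<otimes> h"] g hc by auto
      obtain n' p' where p': "cayley_geodesic G T n' p'" "p' 0 = k0" "p' n' = k1"
        using T.cayley_geodesic_exists[of k0 k1] k by auto
      have sub: "p ` {..n} \<subseteq> carrier G" "p' ` {..n'} \<subseteq> carrier G"
        using p(1) p'(1) by (auto simp: cayley_geodesic_def)
      have "word_dist G S (p 0) (p n) = word_length G S h"
        unfolding p(2,3) S.word_dist_left_mult[OF g S.one_closed hc] using hc
        by (simp add: word_dist_def)
      then have long: "2 * D + 4 * \<delta> + 2 \<le> word_dist G S (p 0) (p n)"
        using far unfolding N_def by linarith
      have ends: "word_dist G S (p 0) (p' 0) \<le> D" "word_dist G S (p n) (p' n') \<le> D"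
        using k(2,4) by (simp_all only: p(2,3) p'(2,3))
      obtain i j where ij: "i \<le> n" "j \<le> n'" "word_dist G S (p i) (p' j) \<le> R"
        using R[OF sub quasi[OF p(1)] quasi[OF p'(1)] ends long] by blast
      have pc: "p i \<in> carrier G" "p' j \<in> carrier G" using sub ij by auto
      have "p' 0 \<in> H" "p' n' \<in> H" using k(1,3) by (simp_all only: p'(2,3))
      then obtain a where a: "a \<in> H" "word_dist G T (p' j) a \<le> \<epsilon>"
        using \<epsilon>[OF p'(1) _ _ ij(2)] by blast
      have cancel: "inv g \<otimes> (g \<otimes> x) = x" "g \<otimes> (inv g \<otimes> x) = x" if "x \<in> carrier G" for x
        using g that by (simp_all add: S.m_assoc[symmetric])
      \<comment> \<open>Translation by \<open>inv g\<close> moves the ends of \<open>p\<close> into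
        \<open>H\<close>, so quasi-convexity of \<open>H\<close> applies; translating back gives the
        point \<open>g \<otimes> b\<close> of the coset.\<close>
      have "inv g \<otimes> p 0 \<in> H" "inv g \<otimes> p n \<in> H"
        using h(1) hc cancel(1) by (simp_all only: p(2,3) S.one_closed H.one_closed)
      then obtain b where b: "b \<in> H" "word_dist G T (inv g \<otimes> p i) b \<le> \<epsilon>"
        using \<epsilon>[OF T.cayley_geodesic_left_mult[OF S.inv_closed[OF g] p(1)] _ _ ij(1)] by blast
      have "word_dist G T (p i) (g \<otimes> b) \<le> \<epsilon>"
        using T.word_dist_left_mult[OF g, of "inv g \<otimes> p i" b] b g pc cancel(2) by simp
      then have "word_dist G S (g \<otimes> b) (p i) \<le> \<Lambda> * \<epsilon>"
        using \<epsilon>'[of "p i" "g \<otimes> b"] S.word_dist_commute[of "p i" "g \<otimes> b"] pc b g by simp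
      moreover have "word_dist G S (p' j) a \<le> \<Lambda> * \<epsilon>"
        using \<epsilon>' a pc by simp
      ultimately have "word_dist G S (g \<otimes> b) a \<le> \<Lambda> * \<epsilon> + R + \<Lambda> * \<epsilon>"
        using S.word_dist_triangle[of "g \<otimes> b" "p i" a] S.word_dist_triangle[of "p i" "p' j" a]
          ij(3) pc a b g by simp
      then show ?thesis using a b by blast
    qed
    then show thesis by (rule that)
  qed
qed

section \<open>Coset algebra of the commensurator\<close>

context group
begin

text \<open>Write \<open>g \<otimes> h = a \<otimes> g\<close> with \<open>a\<close> in the
  conjugate \<open>A\<close>. Finitely many right cosets of \<open>A \<inter> H\<close> fill
  \<open>A\<close>, so \<open>a\<close> lies in \<open>H \<otimes> c\<close> for one of finitely
  many \<open>c\<close>, and the elements \<open>c \<otimes> g\<close> form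
  \<open>T\<close>.\<close>

lemma commensurator_coset_cover:
  assumes H: "subgroup H G" and g: "g \<in> commensurator H G"
  shows "\<exists>T. finite T \<and> T \<subseteq> carrier G \<and> (\<forall>h\<in>H. \<exists>k\<in>H. \<exists>t\<in>T. g \<otimes> h = k \<otimes> t)"
proof -
  interpret H: subgroup H G by fact
  define A where "A = conj_set G g H"
  define \<R> where "\<R> = rcosets\<^bsub>G\<lparr>carrier := A\<rparr>\<^esub> (A \<inter> H)"
  have gc: "g \<in> carrier G" and fin: "finite \<R>"
    using g by (auto simp: commensurator_def finite_index_def A_def \<R>_def)
  have one_A: "\<one> \<in> A"
    unfolding A_def conj_set_def using gc by (intro image_eqI[of _ _ \<one>]) auto
  have Ac: "A \<subseteq> carrier G" unfolding A_def conj_set_def using gc by auto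
  \<comment> \<open>The chosen representative depends only on the coset, which keeps
    \<open>T\<close> finite. It differs from a given \<open>a\<close> in the coset by a left factor
    in \<open>H\<close>.\<close>
  define rep where "rep C = (SOME c. c \<in> C)" for C :: "'a set"
  have rep: "\<exists>k\<in>H. rep ((A \<inter> H) #> a) = k \<otimes> a" if a: "a \<in> A" for a
  proof -
    have "\<one> \<otimes> a \<in> (A \<inter> H) #> a" using one_A H.one_closed unfolding r_coset_def by blast
    then have "rep ((A \<inter> H) #> a) \<in> (A \<inter> H) #> a" unfolding rep_def by (rule someI)
    then show ?thesis by (auto simp: r_coset_def)
  qed
  have \<R>: "\<R> = (\<lambda>a. (A \<inter> H) #> a) ` A"
    by (simp add: \<R>_def RCOSETS_def r_coset_def UNION_singleton_eq_range)
  define T where "T = (\<lambda>C. rep C \<otimes> g) ` \<R>"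
  have "T \<subseteq> carrier G"
  proof
    fix t assume "t \<in> T"
    then obtain a where a: "a \<in> A" "t = rep ((A \<inter> H) #> a) \<otimes> g" by (auto simp: T_def \<R>)
    then obtain k where "k \<in> H" "t = k \<otimes> a \<otimes> g" using rep[OF a(1)] by auto
    then show "t \<in> carrier G" using a Ac gc by auto
  qed
  moreover have "\<exists>k\<in>H. \<exists>t\<in>T. g \<otimes> h = k \<otimes> t" if h: "h \<in> H" for h
  proof -
    define a where "a = g \<otimes> h \<otimes> inv g"
    have a: "a \<in> A" using h by (auto simp: a_def A_def conj_set_def)
    obtain k where k: "k \<in> H" "rep ((A \<inter> H) #> a) = k \<otimes> a" using rep[OF a] by blast
    have c: "a \<in> carrier G" "k \<in> carrier G" "h \<in> carrier G" using a Ac k h by auto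
    have "g \<otimes> h = a \<otimes> g" using c gc by (simp add: a_def m_assoc)
    also have "\<dots> = inv k \<otimes> (k \<otimes> a \<otimes> g)" using c gc by (simp add: m_assoc[symmetric])
    finally have "g \<otimes> h = inv k \<otimes> (rep ((A \<inter> H) #> a) \<otimes> g)" using k by simp
    moreover have "rep ((A \<inter> H) #> a) \<otimes> g \<in> T" using a by (auto simp: T_def \<R>)
    ultimately show ?thesis using k(1) by blast
  qed
  moreover have "finite T" using fin by (simp add: T_def)
  ultimately show ?thesis by blast
qed

lemma conj_set_mem:
  assumes "subgroup H G" "h \<in> H"
  shows "conj_set G h H = H"
proof
  interpret H: subgroup H G by fact
  show "conj_set G h H \<subseteq> H" using assms(2) by (auto simp: conj_set_def)
  show "H \<subseteq> conj_set G h H"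
  proof
    fix x assume x: "x \<in> H"
    have "x = h \<otimes> (inv h \<otimes> x \<otimes> h) \<otimes> inv h"
      using x assms(2) by (simp add: m_assoc) (simp add: m_assoc[symmetric])
    then show "x \<in> conj_set G h H"
      unfolding conj_set_def using x assms(2) by (intro image_eqI[of _ _ "inv h \<otimes> x \<otimes> h"]) auto
  qed
qed

lemma finite_index_refl:
  assumes "subgroup H G"
  shows "finite_index G H H"
proof -
  interpret K: group "G\<lparr>carrier := H\<rparr>" using assms by (rule subgroup_imp_group)
  have "subgroup H (G\<lparr>carrier := H\<rparr>)" using K.subgroup_self by simp
  moreover have "rcosets\<^bsub>G\<lparr>carrier := H\<rparr>\<^esub> H \<subseteq> {H}"
    using coset_join2[OF _ assms] subgroup.subset[OF assms] by (auto simp: RCOSETS_def r_coset_def)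
  ultimately show ?thesis using finite_subset by (auto simp: finite_index_def)
qed

lemma subgroup_subset_commensurator:
  assumes "subgroup H G"
  shows "H \<subseteq> commensurator H G"
  using subgroup.subset[OF assms] finite_index_refl[OF assms] conj_set_mem[OF assms]
  by (auto simp: commensurator_def)

text \<open>Here \<open>K\<close> is merely a set, so the inverse in the restricted structure has to
  be computed from its definition: for \<open>x \<in> H\<close> the inverse in \<open>G\<close> lies
  in \<open>K\<close> and is the unique candidate.\<close>

lemma subgroup_of_superset:
  assumes H: "subgroup H G" and "H \<subseteq> K" "K \<subseteq> carrier G"
  shows "subgroup H (G\<lparr>carrier := K\<rparr>)"
proof -
  interpret H: subgroup H G by fact
  have "m_inv (G\<lparr>carrier := K\<rparr>) x = inv x" if x: "x \<in> H" for x
  proof -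
    have "inv x \<in> K" "x \<in> carrier G" using x assms(2) by auto
    then show ?thesis
      unfolding m_inv_def[of "G\<lparr>carrier := K\<rparr>"] using assms(3) inv_unique'
      by (intro the_equality) auto
  qed
  then show ?thesis using assms(2) by unfold_locales auto
qed

end

section \<open>Counting the right cosets of \<open>H\<close> in its commensurator\<close>

theorem theorem16:
  fixes G :: "('a, 'b) monoid_scheme" and H :: "'a set"
  assumes "word_hyperbolic_group G"
    and "quasiconvex_subgroup H G"
    and "infinite H"
  shows "finite_index G H (commensurator H G)"
proof -
  obtain S where S: "group G" "finite_generating_set G S"
      "gromov_hyperbolic (carrier G) (word_dist G S)"
    using assms(1) by (auto simp: word_hyperbolic_group_def)
  obtain T where T: "subgroup H G" "finite_generating_set G T" "quasiconvex_wrt G T H"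
    using assms(2) by (auto simp: quasiconvex_subgroup_def)
  interpret group G by fact
  interpret S: finitely_generated_group G S by unfold_locales fact
  have T': "finitely_generated_group G T" by unfold_locales fact
  interpret H: subgroup H G by fact
  \<comment> \<open>This expresses \<open>bH \<subseteq> HB\<close> for a finite
    \<open>B\<close>.\<close>
  define covers where "covers b B \<longleftrightarrow> finite B \<and> B \<subseteq> carrier G \<and>
    (\<forall>h\<in>H. \<exists>k\<in>H. \<exists>t\<in>B. b \<otimes>\<^bsub>G\<^esub> h = k \<otimes>\<^bsub>G\<^esub> t)" for b B
  have comm: "commensurator H G \<subseteq> carrier G" by (auto simp: commensurator_def)
  have "finite (rcosets\<^bsub>G\<lparr>carrier := commensurator H G\<rparr>\<^esub> H)"
  proof (rule close_cosets_uniformly_close[OF S.finitely_generated_group_axioms S(3) T' T(3,1) assms(3)])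
    fix R assume R: "\<And>g D. \<lbrakk>g \<in> carrier G;
        \<And>h. h \<in> H \<Longrightarrow> \<exists>k\<in>H. word_dist G S (g \<otimes>\<^bsub>G\<^esub> h) k \<le> D\<rbrakk> \<Longrightarrow>
      \<exists>h\<in>H. \<exists>k\<in>H. word_dist G S (g \<otimes>\<^bsub>G\<^esub> h) k \<le> R"
    define N where "N = nat \<lfloor>R\<rfloor>"
    define \<B> where "\<B> = {b \<in> carrier G. word_length G S b \<le> N}"
    \<comment> \<open>The choice depends on \<open>b\<close> alone and not on \<open>g\<close>;
      hence the union below, over the finite ball, is finite.\<close>
    define cover where "cover b = (SOME B. covers b B)" for b
    have "rcosets\<^bsub>G\<lparr>carrier := commensurator H G\<rparr>\<^esub> H \<subseteq>
        (\<Union>b\<in>{b\<in>\<B>. \<exists>B. covers b B}. (\<lambda>t. H #>\<^bsub>G\<^esub> t) ` cover b)"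
    proof
      fix C assume "C \<in> rcosets\<^bsub>G\<lparr>carrier := commensurator H G\<rparr>\<^esub> H"
      then obtain g where g: "g \<in> commensurator H G" and C: "C = H #>\<^bsub>G\<^esub> g"
        by (auto simp: RCOSETS_def r_coset_def)
      have gc: "g \<in> carrier G" using g comm by blast
      obtain B where B: "covers g B"
        using commensurator_coset_cover[OF T(1) g] unfolding covers_def by blast
      have finB: "finite B" using B by (simp add: covers_def)
      \<comment> \<open>If \<open>gh = kt\<close> with \<open>t \<in> B\<close>, then
        \<open>gh\<close> is at distance \<open>word_length G S t\<close> from \<open>k\<close>.
        \<open>D\<close> may depend on \<open>g\<close>, whereas \<open>R\<close> does not.\<close>
      define D where "D = real (Max (word_length G S ` B))"
      have "\<exists>k\<in>H. word_dist G S (g \<otimes>\<^bsub>G\<^esub> h) k \<le> D" if h: "h \<in> H" for h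
      proof -
        obtain k t where kt: "k \<in> H" "t \<in> B" "g \<otimes>\<^bsub>G\<^esub> h = k \<otimes>\<^bsub>G\<^esub> t"
          using B h unfolding covers_def by blast
        have t: "t \<in> carrier G" using B kt by (auto simp: covers_def)
        have "word_dist G S (g \<otimes>\<^bsub>G\<^esub> h) k = word_dist G S k (k \<otimes>\<^bsub>G\<^esub> t)"
          using S.word_dist_commute kt t by simp
        also have "\<dots> = real (word_length G S t)"
          using kt t by (simp add: word_dist_def m_assoc[symmetric])
        also have "\<dots> \<le> D" unfolding D_def using finB kt by simp
        finally show ?thesis using kt by blast
      qed
      then obtain h k where hk: "h \<in> H" "k \<in> H" "word_dist G S (g \<otimes>\<^bsub>G\<^esub> h) k \<le> R"
        using R[OF gc] by blast
      define b where "b = inv\<^bsub>G\<^esub> k \<otimes>\<^bsub>G\<^esub> (g \<otimes>\<^bsub>G\<^esub> h)"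
      have hkc: "h \<in> carrier G" "k \<in> carrier G" using hk by auto
      have bc: "b \<in> carrier G" using hkc gc by (simp add: b_def)
      have "real (word_length G S b) \<le> R"
        using hk(3) S.word_dist_commute[of "g \<otimes>\<^bsub>G\<^esub> h" k] hkc gc by (simp add: word_dist_def b_def)
      then have "b \<in> \<B>" using bc unfolding \<B>_def N_def by (simp add: le_nat_floor)
      \<comment> \<open>Since \<open>bx = inv k (g(hx))\<close> and \<open>hx \<in> H\<close>, the
        set \<open>B\<close> for \<open>g\<close> also serves \<open>b\<close>; so
        \<open>cover b\<close> is a genuine cover.\<close>
      moreover have "covers b B"
        unfolding covers_def
      proof (intro conjI ballI)
        fix x assume x: "x \<in> H"
        obtain l t where lt: "l \<in> H" "t \<in> B" "g \<otimes>\<^bsub>G\<^esub> (h \<otimes>\<^bsub>G\<^esub> x) = l \<otimes>\<^bsub>G\<^esub> t"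
          using B hk x unfolding covers_def by (meson H.m_closed)
        have t: "t \<in> carrier G" using B lt by (auto simp: covers_def)
        have "b \<otimes>\<^bsub>G\<^esub> x = inv\<^bsub>G\<^esub> k \<otimes>\<^bsub>G\<^esub> (g \<otimes>\<^bsub>G\<^esub> (h \<otimes>\<^bsub>G\<^esub> x))"
          using hkc gc x by (simp add: b_def m_assoc)
        also have "\<dots> = (inv\<^bsub>G\<^esub> k \<otimes>\<^bsub>G\<^esub> l) \<otimes>\<^bsub>G\<^esub> t"
          unfolding lt(3) using hkc lt(1) t by (simp add: m_assoc)
        finally show "\<exists>k\<in>H. \<exists>t\<in>B. b \<otimes>\<^bsub>G\<^esub> x = k \<otimes>\<^bsub>G\<^esub> t" using hk(2) lt by blast
      qed (use B in \<open>auto simp: covers_def\<close>)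
      ultimately have b: "b \<in> {b\<in>\<B>. \<exists>B. covers b B}" by blast
      have cov: "covers b (cover b)"
        unfolding cover_def using \<open>covers b B\<close> by (rule someI)
      obtain l t where lt: "l \<in> H" "t \<in> cover b" "b \<otimes>\<^bsub>G\<^esub> inv\<^bsub>G\<^esub> h = l \<otimes>\<^bsub>G\<^esub> t"
        using cov hk(1) unfolding covers_def by blast
      have t: "t \<in> carrier G" using cov lt by (auto simp: covers_def)
      \<comment> \<open>Solving for \<open>g\<close> gives \<open>g = k(b inv h)\<close>, and
        \<open>b inv h\<close> lies in \<open>Ht\<close> with \<open>t \<in> cover b\<close>, so
        \<open>Hg = Ht\<close>.\<close>
      have "b \<otimes>\<^bsub>G\<^esub> inv\<^bsub>G\<^esub> h = inv\<^bsub>G\<^esub> k \<otimes>\<^bsub>G\<^esub> g"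
        using hkc gc by (simp add: b_def m_assoc)
      then have "g = k \<otimes>\<^bsub>G\<^esub> (l \<otimes>\<^bsub>G\<^esub> t)"
        using lt(3) hkc gc by (metis inv_closed inv_solve_left m_closed)
      then have "g = (k \<otimes>\<^bsub>G\<^esub> l) \<otimes>\<^bsub>G\<^esub> t" using hkc lt(1) t by (simp add: m_assoc)
      then have "g \<in> H #>\<^bsub>G\<^esub> t" using hk(2) lt(1) by (auto simp: r_coset_def)
      then have "C = H #>\<^bsub>G\<^esub> t" unfolding C using repr_independence[OF _ t T(1)] by simp
      then show "C \<in> (\<Union>b\<in>{b\<in>\<B>. \<exists>B. covers b B}. (\<lambda>t. H #>\<^bsub>G\<^esub> t) ` cover b)"
        using b lt(2) by blast
    qed
    moreover have "finite (cover b)" if "\<exists>B. covers b B" for b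
      using someI_ex[OF that] by (simp add: cover_def covers_def)
    moreover have "finite {b\<in>\<B>. \<exists>B. covers b B}"
      unfolding \<B>_def by (rule finite_subset[OF _ S.finite_word_ball]) auto
    ultimately show ?thesis by (auto intro: finite_subset)
  qed
  then show ?thesis
    using subgroup_of_superset[OF T(1) subgroup_subset_commensurator[OF T(1)] comm]
    by (simp add: finite_index_def)
qed

end
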